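(* Let $n\ge2$ and let $\mathbf A$ be a real $n\times n$ $\mathcal J$-sign-symmetric matrix whose second compound matrix $\mathbf A^{(2)}$ is also $\mathcal J$-sign-symmetric. Let $\mathcal J\subseteq\{1,\dots,n\}$ and $\widetilde{\mathcal J}\subseteq\{1,\dots,\binom n2\}$ be sets witnessing the $\mathcal J$-sign-symmetricity of $\mathbf A$ and of $\mathbf A^{(2)}$ respectively, and suppose that the associated set $\widehat W(\mathcal J,\widetilde{\mathcal J})$ is transitive. Then the two largest in modulus eigenvalues of $\mathbf A$ are nonnegative; that is, the eigenvalues of $\mathbf A$, counted with algebraic multiplicity, can be enumerated so that $|\lambda_1|\ge|\lambda_2|\ge\dots\ge|\lambda_n|$ with $\lambda_1,\lambda_2$ real and nonnegative.
   Context: A real $m\times m$ matrix $\mathbf B=(b_{ij})$ is $\mathcal J$-sign-symmetric if there is a subset $\mathcal J\subseteq\{1,\dots,m\}$ (a witness) such that $b_{ij}\le 0$ whenever exactly one of $i,j$ belongs to $\mathcal J$, and $b_{ij}<0$ only if exactly one of $i,j$ belongs to $\mathcal J$. The second compound matrix $\mathbf A^{(2)}$ is the $\binom n2\times\binom n2$ matrix of minors $A\begin{pmatrix} i&j\\k&l\end{pmatrix}=a_{ik}a_{jl}-a_{il}a_{jk}$, with rows indexed by pairs $(i,j)$, $i<j$, and columns by pairs $(k,l)$, $k<l$, pairs being numbered $1,\dots,\binom n2$ in lexicographic order. The set $\widehat W(\mathcal J,\widetilde{\mathcal J})\subseteq\{1,\dots,n\}\times\{1,\dots,n\}$ contains all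 pairs $(i,i)$, and for $i\ne j$ a pair $(i,j)$ belongs to it if and only if one of the following holds: (a) $i<j$, the numbers $i,j$ are both in $\mathcal J$ or both in $\{1,\dots,n\}\setminus\mathcal J$, and the lexicographic number of $(i,j)$ lies in $\widetilde{\mathcal J}$; (b) $i<j$, exactly one of $i,j$ lies in $\mathcal J$, and the lexicographic number of $(i,j)$ does not lie in $\widetilde{\mathcal J}$; (c) $i>j$, the numbers $i,j$ are both in $\mathcal J$ or both in $\{1,\dots,n\}\setminus\mathcal J$, and the lexicographic number of $(j,i)$ does not lie in $\widetilde{\mathcal J}$; (d) $i>j$, exactly one of $i,j$ lies in $\mathcal J$, and the lexicographic number of $(j,i)$ lies in $\widetilde{\mathcal J}$. The set is called transitive if the binary relation $i\prec j\iff(i,j)\in\widehat W(\mathcal J,\widetilde{\mathcal J})$ is a linear order on $\{1,\dots,n\}$. *)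

theory Defs
  imports Complex_Main "HOL-Library.Nonpos_Ints" "Jordan_Normal_Form.Char_Poly"
begin

text \<open>All index sets are numbered from 0, as is usual for \<^typ>\<open>'a mat\<close>: the rows and columns of an
  \<open>m \<times> m\<close> matrix are \<open>{..<m}\<close> instead of \<open>{1,\<dots>,m}\<close>, and the pairs \<open>i < j\<close> have the numbers
  \<open>0,\<dots>,(n choose 2) - 1\<close> in lexicographic order.\<close>

definition exactly_one_in :: "nat set \<Rightarrow> nat \<Rightarrow> nat \<Rightarrow> bool" where
  "exactly_one_in J i j \<longleftrightarrow> (i \<in> J) \<noteq> (j \<in> J)"

definition J_sign_symmetric_witness :: "real mat \<Rightarrow> nat set \<Rightarrow> bool" where
  "J_sign_symmetric_witness B J \<longleftrightarrow>
     square_mat B \<and> J \<subseteq> {..<dim_row B} \<and>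
     (\<forall>i<dim_row B. \<forall>j<dim_row B.
        (exactly_one_in J i j \<longrightarrow> B $$ (i, j) \<le> 0) \<and>
        (B $$ (i, j) < 0 \<longrightarrow> exactly_one_in J i j))"

definition lex_pairs :: "nat \<Rightarrow> (nat \<times> nat) list" where
  "lex_pairs n = concat (map (\<lambda>i. map (Pair i) [Suc i..<n]) [0..<n])"

definition lex_number :: "nat \<Rightarrow> nat \<Rightarrow> nat \<Rightarrow> nat" where
  "lex_number n i j = (THE p. p < n choose 2 \<and> lex_pairs n ! p = (i, j))"

definition minor2 :: "'a :: comm_ring_1 mat \<Rightarrow> nat \<times> nat \<Rightarrow> nat \<times> nat \<Rightarrow> 'a" where
  "minor2 A = (\<lambda>(i, j) (k, l). A $$ (i, k) * A $$ (j, l) - A $$ (i, l) * A $$ (j, k))"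

definition second_compound :: "'a :: comm_ring_1 mat \<Rightarrow> 'a mat" where
  "second_compound A =
     (let n = dim_row A
      in mat (n choose 2) (n choose 2) (\<lambda>(p, q). minor2 A (lex_pairs n ! p) (lex_pairs n ! q)))"

definition W_hat :: "nat \<Rightarrow> nat set \<Rightarrow> nat set \<Rightarrow> (nat \<times> nat) set" where
  "W_hat n J J' = {(i, j). i < n \<and> j < n \<and>
     (i = j
      \<or> i < j \<and> \<not> exactly_one_in J i j \<and> lex_number n i j \<in> J'
      \<or> i < j \<and> exactly_one_in J i j \<and> lex_number n i j \<notin> J'
      \<or> i > j \<and> \<not> exactly_one_in J i j \<and> lex_number n j i \<notin> J'
      \<or> i > j \<and> exactly_one_in J i j \<and> lex_number n j i \<in> J')}"

definition W_hat_transitive :: "nat \<Rightarrow> nat set \<Rightarrow> nat set \<Rightarrow> bool" where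
  "W_hat_transitive n J J' \<longleftrightarrow> linear_order_on {..<n} (W_hat n J J')"

text \<open>The eigenvalues are complex and listed with algebraic multiplicity, as the roots of the
  characteristic polynomial.\<close>

definition eigenvalue_enumeration :: "real mat \<Rightarrow> complex list \<Rightarrow> bool" where
  "eigenvalue_enumeration A es \<longleftrightarrow>
     char_poly (map_mat complex_of_real A) = (\<Prod>e\<leftarrow>es. [:- e, 1:])"

lemma set_lex_pairs: "set (lex_pairs n) = {(i, j). i < j \<and> j < n}"
  by (force simp: lex_pairs_def)

lemma sorted_lex_pairs:
  "sorted_wrt (\<lambda>(i, j) (k, l). i < k \<or> i = k \<and> j < l) (lex_pairs n)"
proof -
  have "sorted_wrt (\<lambda>(i, j) (k, l). i < k \<or> i = k \<and> j < l)
          (concat (map (\<lambda>i. map (Pair i) [Suc i..<n]) [0..<m]))" for m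
    by (induction m) (auto simp: sorted_wrt_append sorted_wrt_map)
  then show ?thesis
    by (simp add: lex_pairs_def)
qed

lemma distinct_lex_pairs: "distinct (lex_pairs n)"
proof -
  have "distinct xs" if "sorted_wrt (\<lambda>(i, j) (k, l). i < k \<or> i = k \<and> j < l) xs" for xs :: "(nat \<times> nat) list"
    using that by (induction xs) auto
  then show ?thesis
    using sorted_lex_pairs by blast
qed

lemma length_lex_pairs: "length (lex_pairs n) = n choose 2"
proof -
  have "length (lex_pairs n) = (\<Sum>i<n. n - Suc i)"
    by (simp add: lex_pairs_def length_concat comp_def interv_sum_list_conv_sum_set_nat atLeast0LessThan)
  also have "\<dots> = (\<Sum>i<n. i)"
    by (rule sum.nat_diff_reindex)
  also have "\<dots> = n choose 2"
    by (induction n) (auto simp: numeral_2_eq_2)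
  finally show ?thesis .
qed

lemma lex_number_less: "lex_number n i j < n choose 2"
  and nth_lex_number: "lex_pairs n ! lex_number n i j = (i, j)"
  if "i < j" "j < n"
proof -
  have "(i, j) \<in> set (lex_pairs n)"
    using that by (simp add: set_lex_pairs)
  then obtain p where "p < n choose 2" "lex_pairs n ! p = (i, j)"
    by (metis in_set_conv_nth length_lex_pairs)
  then have "\<exists>!p. p < n choose 2 \<and> lex_pairs n ! p = (i, j)"
    using distinct_lex_pairs length_lex_pairs by (metis nth_eq_iff_index_eq)
  from theI'[OF this] show "lex_number n i j < n choose 2" "lex_pairs n ! lex_number n i j = (i, j)"
    by (auto simp: lex_number_def)
qed

lemma second_compound_carrier:
  "A \<in> carrier_mat n n \<Longrightarrow> second_compound A \<in> carrier_mat (n choose 2) (n choose 2)"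
  by (auto simp: second_compound_def Let_def)

lemma second_compound_lex_number:
  assumes "A \<in> carrier_mat n n" "i < j" "j < n" "k < l" "l < n"
  shows "second_compound A $$ (lex_number n i j, lex_number n k l) =
           A $$ (i, k) * A $$ (j, l) - A $$ (i, l) * A $$ (j, k)"
  using assms
  by (simp add: second_compound_def minor2_def lex_number_less nth_lex_number)

lemma length_eigenvalue_enumeration:
  assumes "A \<in> carrier_mat n n" "eigenvalue_enumeration A es"
  shows "length es = n"
proof -
  have "degree (char_poly (map_mat complex_of_real A)) = n"
    using assms(1) by (intro degree_monic_char_poly[THEN conjunct1]) auto
  moreover have "degree (\<Prod>e\<leftarrow>es. [:- e, 1:]) = length es"
    by (simp add: degree_linear_factors)
  ultimately show ?thesis
    using assms(2) by (simp add: eigenvalue_enumeration_def)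
qed

end

theory Submission
  imports Defs "Jordan_Normal_Form.Spectral_Radius" "Jordan_Normal_Form.Schur_Decomposition"
begin

text \<open>Conjugation by a signature matrix turns \<open>A\<close> into a nonnegative matrix \<open>B\<close>, and \<open>A\<^sup>(\<^sup>2\<^sup>)\<close> likewise; by
  Perron--Frobenius the spectral radii \<open>\<rho>\<close> of \<open>A\<close> and \<open>\<theta>\<close> of \<open>A\<^sup>(\<^sup>2\<^sup>)\<close> are eigenvalues. If the second
  largest modulus \<open>r\<close> satisfies \<open>0 < r < \<rho>\<close>, then \<open>\<theta> = \<rho> r\<close> is a product of two eigenvalues of \<open>A\<close>, one of
  which must be \<open>\<rho>\<close>, so the other one is \<open>r\<close>. The case \<open>r = \<rho>\<close> needs the linear order \<open>W_hat\<close>: with respect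
  to it all minors of order two of \<open>B\<close> are nonnegative, so a product of entries of \<open>B\<close> along a permutation
  can be uncrossed and is at most the product of the diagonal entries. Hence an index with zero
  diagonal entry lies on no cycle and does not matter for the spectrum away from 0; for the other indices
  \<open>B - \<delta>\<close> is still nonnegative for some \<open>\<delta> > 0\<close>, and \<open>\<rho>\<close> is the only eigenvalue with \<open>\<bar>e\<bar> = \<rho>\<close> because
  \<open>\<bar>e - \<delta>\<bar> \<le> \<rho> - \<delta>\<close>.\<close>

section \<open>Nonnegative matrices\<close>

abbreviation cmat :: "real mat \<Rightarrow> complex mat" where
  "cmat A \<equiv> map_mat complex_of_real A"

lemma index_mult_mat_vec_sum:
  assumes "A \<in> carrier_mat m n" "v \<in> carrier_vec n" "i < m"
  shows "(A *\<^sub>v v) $ i = (\<Sum>j = 0..<n. A $$ (i, j) * v $ j)"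
  using assms by (simp add: scalar_prod_def)

lemma smult_mat_mult_vec:
  fixes A :: "'a :: comm_ring_1 mat"
  assumes "A \<in> carrier_mat m n" "v \<in> carrier_vec n"
  shows "(a \<cdot>\<^sub>m A) *\<^sub>v v = a \<cdot>\<^sub>v (A *\<^sub>v v)"
  using assms by (intro eq_vecI) auto

lemma norm_eigenvalue_le_spectral_radius:
  assumes "A \<in> carrier_mat n n" "eigenvalue A e"
  shows "cmod e \<le> spectral_radius A"
  using spectral_radius_mem_max(2)[OF assms(1) eigenvalue_imp_nonzero_dim[OF assms]] assms(2)
  by (auto simp: spectrum_def)

lemma nonneg_mat_pow:
  fixes A :: "real mat"
  assumes A: "A \<in> carrier_mat n n" and nonneg: "\<And>i j. i < n \<Longrightarrow> j < n \<Longrightarrow> 0 \<le> A $$ (i, j)"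
    and ij: "i < n" "j < n"
  shows "0 \<le> (A ^\<^sub>m k) $$ (i, j)"
  using ij
proof (induction k arbitrary: i j)
  case 0
  then show ?case using A by simp
next
  case (Suc k)
  have "A ^\<^sub>m k \<in> carrier_mat n n" using A by simp
  then have "(A ^\<^sub>m Suc k) $$ (i, j) = (\<Sum>l = 0..<n. (A ^\<^sub>m k) $$ (i, l) * A $$ (l, j))"
    using A Suc.prems by (simp add: scalar_prod_def)
  also have "\<dots> \<ge> 0"
    using Suc nonneg by (intro sum_nonneg mult_nonneg_nonneg) auto
  finally show ?case .
qed

text \<open>Dividing by \<open>s\<close> moves all eigenvalues into the open unit disc, where the
  Jordan normal form bounds the entries of all powers by one constant.\<close>

lemma mat_pow_bounded:
  fixes A :: "real mat"
  assumes A: "A \<in> carrier_mat n n" and s: "spectral_radius (cmat A) < s" "0 < s"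
  obtains c where "\<And>k i j. i < n \<Longrightarrow> j < n \<Longrightarrow> \<bar>((inverse s \<cdot>\<^sub>m A) ^\<^sub>m k) $$ (i, j)\<bar> \<le> c"
proof (cases "n = 0")
  case True
  then show ?thesis using that by auto
next
  case False
  define M where "M = inverse s \<cdot>\<^sub>m A"
  have M: "M \<in> carrier_mat n n" and cM: "cmat M \<in> carrier_mat n n" using A by (auto simp: M_def)
  have "cmod e < 1" if ev: "eigenvalue (cmat M) e" for e
  proof -
    obtain v where v: "v \<in> carrier_vec n" "v \<noteq> 0\<^sub>v n" "cmat M *\<^sub>v v = e \<cdot>\<^sub>v v"
      using ev A by (auto simp: eigenvalue_def eigenvector_def M_def)
    have "cmat A = of_real s \<cdot>\<^sub>m cmat M"
      using A s by (intro eq_matI) (auto simp: M_def)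
    then have "cmat A *\<^sub>v v = (of_real s * e) \<cdot>\<^sub>v v"
      using v cM by (simp add: smult_mat_mult_vec[of _ n n] smult_smult_assoc)
    then have "eigenvalue (cmat A) (of_real s * e)"
      using v A by (auto simp: eigenvalue_def eigenvector_def intro!: exI[of _ v])
    then have "cmod (of_real s * e) \<le> spectral_radius (cmat A)"
      using A by (intro norm_eigenvalue_le_spectral_radius) auto
    then have "s * cmod e < s"
      using s by (simp add: norm_mult order.strict_trans1)
    then show ?thesis using s by simp
  qed
  then have "spectral_radius (cmat M) < 1"
    using spectral_radius_mem_max(1)[OF cM] False by (auto simp: spectrum_def)
  from spectral_radius_jnf_norm_bound_less_1_upper_triangular[OF cM this]
  obtain c where c: "\<And>k. norm_bound (cmat M ^\<^sub>m k) c" by auto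
  have "\<bar>(M ^\<^sub>m k) $$ (i, j)\<bar> \<le> c" if "i < n" "j < n" for k i j
  proof -
    have "cmat M ^\<^sub>m k = cmat (M ^\<^sub>m k)"
      by (rule of_real_hom.mat_hom_pow[OF M, symmetric])
    then have "norm ((cmat M ^\<^sub>m k) $$ (i, j)) = \<bar>(M ^\<^sub>m k) $$ (i, j)\<bar>"
      using that carrier_matD[OF pow_carrier_mat[OF M, of k]] by simp
    moreover have "norm ((cmat M ^\<^sub>m k) $$ (i, j)) \<le> c"
      using c[of k] that M by (auto simp: norm_bound_def)
    ultimately show ?thesis by simp
  qed
  then show ?thesis using that unfolding M_def by blast
qed

lemma spectral_radius_nonneg:
  assumes "A \<in> carrier_mat n n" "0 < n"
  shows "0 \<le> spectral_radius A"
  using spectral_radius_mem_max(1)[OF assms] by auto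

text \<open>Iterating \<open>A z \<le> t z\<close> bounds \<open>z\<close> from below by \<open>(A/t)\<^sup>k z\<close>, which tends to 0.\<close>

lemma nonneg_if_mult_le:
  fixes A :: "real mat"
  assumes A: "A \<in> carrier_mat n n" and nonneg: "\<And>i j. i < n \<Longrightarrow> j < n \<Longrightarrow> 0 \<le> A $$ (i, j)"
    and t: "spectral_radius (cmat A) < t"
    and z: "z \<in> carrier_vec n" "\<And>i. i < n \<Longrightarrow> (A *\<^sub>v z) $ i \<le> t * z $ i"
    and i: "i < n"
  shows "0 \<le> z $ i"
proof -
  \<comment> \<open>The gap is split in two: \<open>s\<close> above the spectral radius keeps the
    powers of \<open>A/s\<close> bounded, while the ratio \<open>s/t < 1\<close> supplies the
    geometric decay.\<close>
  obtain s where s: "spectral_radius (cmat A) < s" "s < t" using t dense by blast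
  have "0 \<le> spectral_radius (cmat A)"
    using i A by (intro spectral_radius_nonneg[of _ n]) auto
  then have s0: "0 < s" using s by simp
  obtain c where c: "\<And>k i j. i < n \<Longrightarrow> j < n \<Longrightarrow> \<bar>((inverse s \<cdot>\<^sub>m A) ^\<^sub>m k) $$ (i, j)\<bar> \<le> c"
    using mat_pow_bounded[OF A s(1) s0] by metis
  define M where "M = inverse s \<cdot>\<^sub>m A"
  define r where "r = s / t"
  have r: "0 < r" "r < 1" using s s0 by (auto simp: r_def)
  have M: "M \<in> carrier_mat n n" using A by (simp add: M_def)
  have M0: "0 \<le> M $$ (i, j)" if "i < n" "j < n" for i j
    using nonneg[OF that] that A s0 by (simp add: M_def)
  have Mz: "r * (M *\<^sub>v z) $ l \<le> z $ l" if "l < n" for l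
  proof -
    have "M *\<^sub>v z = inverse s \<cdot>\<^sub>v (A *\<^sub>v z)"
      using A z by (simp add: M_def smult_mat_mult_vec)
    then have "r * (M *\<^sub>v z) $ l = (A *\<^sub>v z) $ l / t"
      using that A s0 by (simp add: r_def)
    also have "\<dots> \<le> z $ l" using z(2)[OF that] s s0 by (simp add: divide_le_eq mult.commute)
    finally show ?thesis .
  qed
  have lower: "r ^ k * (M ^\<^sub>m k *\<^sub>v z) $ l \<le> z $ l" if "l < n" for k l
    using that
  proof (induction k)
    case 0
    then show ?case using M z by simp
  next
    case (Suc k)
    have Mk: "M ^\<^sub>m k \<in> carrier_mat n n" using M by simp
    have "r ^ Suc k * (M ^\<^sub>m Suc k *\<^sub>v z) $ l
        = r ^ k * (\<Sum>j = 0..<n. (M ^\<^sub>m k) $$ (l, j) * (r * (M *\<^sub>v z) $ j))"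
    proof -
      have "M ^\<^sub>m Suc k *\<^sub>v z = M ^\<^sub>m k *\<^sub>v (M *\<^sub>v z)"
        using M z assoc_mult_mat_vec[OF Mk M] by simp
      then have "(M ^\<^sub>m Suc k *\<^sub>v z) $ l = (\<Sum>j = 0..<n. (M ^\<^sub>m k) $$ (l, j) * (M *\<^sub>v z) $ j)"
        using index_mult_mat_vec_sum[OF Mk, of "M *\<^sub>v z" l] M z Suc.prems
          by (simp del: index_mult_mat_vec)
      then show ?thesis by (simp add: sum_distrib_left mult_ac)
    qed
    also have "\<dots> \<le> r ^ k * (\<Sum>j = 0..<n. (M ^\<^sub>m k) $$ (l, j) * z $ j)"
      using r Mz nonneg_mat_pow[OF M M0] Suc.prems
      by (intro mult_left_mono sum_mono) auto
    also have "\<dots> = r ^ k * (M ^\<^sub>m k *\<^sub>v z) $ l"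
      using Mk Suc.prems z by (simp del: index_mult_mat_vec add: index_mult_mat_vec_sum[of _ n n])
    also have "\<dots> \<le> z $ l" using Suc by simp
    finally show ?case .
  qed
  have "r ^ k * (- (c * (\<Sum>j = 0..<n. \<bar>z $ j\<bar>))) \<le> z $ i" for k
  proof -
    have Mk: "M ^\<^sub>m k \<in> carrier_mat n n" using M by simp
    have "\<bar>(M ^\<^sub>m k *\<^sub>v z) $ i\<bar> = \<bar>\<Sum>j = 0..<n. (M ^\<^sub>m k) $$ (i, j) * z $ j\<bar>"
      using Mk i z by (simp del: index_mult_mat_vec add: index_mult_mat_vec_sum[of _ n n])
    also have "\<dots> \<le> (\<Sum>j = 0..<n. \<bar>(M ^\<^sub>m k) $$ (i, j)\<bar> * \<bar>z $ j\<bar>)"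
      by (rule order_trans[OF sum_abs]) (simp add: abs_mult)
    also have "\<dots> \<le> (\<Sum>j = 0..<n. c * \<bar>z $ j\<bar>)"
      using c i unfolding M_def by (intro sum_mono mult_right_mono) auto
    finally have "- (c * (\<Sum>j = 0..<n. \<bar>z $ j\<bar>)) \<le> (M ^\<^sub>m k *\<^sub>v z) $ i"
      by (simp add: sum_distrib_left)
    then have "r ^ k * (- (c * (\<Sum>j = 0..<n. \<bar>z $ j\<bar>))) \<le> r ^ k * (M ^\<^sub>m k *\<^sub>v z) $ i"
      using r by (intro mult_left_mono) auto
    then show ?thesis using lower[OF i, of k] by linarith
  qed
  moreover have "(\<lambda>k. r ^ k * (- (c * (\<Sum>j = 0..<n. \<bar>z $ j\<bar>)))) \<longlonglongrightarrow> 0 * (- (c * (\<Sum>j = 0..<n. \<bar>z $ j\<bar>)))"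
    using r by (intro tendsto_mult tendsto_const LIMSEQ_realpow_zero) auto
  ultimately show ?thesis
    by (intro LIMSEQ_le_const2) auto
qed

section \<open>Perron-Frobenius by continuity of determinants\<close>

lemma continuous_on_det:
  fixes M :: "real \<Rightarrow> real mat"
  assumes "\<And>t. M t \<in> carrier_mat n n"
    and "\<And>i j. i < n \<Longrightarrow> j < n \<Longrightarrow> continuous_on UNIV (\<lambda>t. M t $$ (i, j))"
  shows "continuous_on UNIV (\<lambda>t. det (M t))"
  unfolding det_def'[OF assms(1)]
proof (intro continuous_intros)
  fix p i assume "p \<in> {p. p permutes {0..<n}}" "i \<in> {0..<n}"
  then show "continuous_on UNIV (\<lambda>t. M t $$ (i, p i))"
    by (intro assms(2)) (auto simp: permutes_in_image)
qed

text \<open>At a real point, being a complex eigenvalue becomes the vanishing of a real determinant,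
  so the limit argument can stay over the reals.\<close>

lemma eigenvalue_cmat_of_real:
  fixes A :: "real mat"
  assumes A: "A \<in> carrier_mat n n"
  shows "eigenvalue (cmat A) (of_real t) \<longleftrightarrow> det (t \<cdot>\<^sub>m 1\<^sub>m n - A) = 0"
proof -
  have "eigenvalue (cmat A) (of_real t) \<longleftrightarrow> poly (char_poly (cmat A)) (of_real t) = 0"
    using A by (intro eigenvalue_root_char_poly) auto
  also have "char_poly (cmat A) = map_poly of_real (char_poly A)"
    using of_real_hom.char_poly_hom[OF A] by simp
  also have "poly \<dots> (of_real t) = complex_of_real (poly (char_poly A) t)"
    by simp
  also have "poly (char_poly A) t = det (- char_matrix A t)"
    by (rule char_poly_matrix[OF A])
  also have "- char_matrix A t = t \<cdot>\<^sub>m 1\<^sub>m n - A"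
    using A by (intro eq_matI) (auto simp: char_matrix_def)
  finally show ?thesis by simp
qed

text \<open>Let \<open>x\<close> consist of the moduli of a peripheral eigenvector, so that \<open>u = A x - \<rho> x\<close> is nonnegative. If \<open>\<rho>\<close>
  were no eigenvalue, then \<open>- x\<close>, the solution of \<open>(\<rho> - A) y = u\<close>, would be the limit of the nonnegative
  solutions of \<open>(t - A) y = u\<close> for \<open>t \<down> \<rho>\<close>.\<close>

lemma nonneg_mat_eigenvalue_spectral_radius:
  fixes A :: "real mat"
  assumes A: "A \<in> carrier_mat n n" and nonneg: "\<And>i j. i < n \<Longrightarrow> j < n \<Longrightarrow> 0 \<le> A $$ (i, j)"
    and n: "0 < n"
  shows "eigenvalue (cmat A) (of_real (spectral_radius (cmat A)))"
proof (rule ccontr)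
  define \<rho> where "\<rho> = spectral_radius (cmat A)"
  define R where "R = (\<lambda>t. t \<cdot>\<^sub>m 1\<^sub>m n - A)"
  assume "\<not> ?thesis"
  then have det\<rho>: "det (R \<rho>) \<noteq> 0"
    using eigenvalue_cmat_of_real[OF A] by (simp add: \<rho>_def R_def)
  have R: "R t \<in> carrier_mat n n" for t using A by (auto simp: R_def)
  have R_mult: "(R t *\<^sub>v v) $ i = t * v $ i - (A *\<^sub>v v) $ i" if "v \<in> carrier_vec n" "i < n" for t v i
  proof -
    have "R t *\<^sub>v v = t \<cdot>\<^sub>v v - A *\<^sub>v v"
      using that A minus_mult_distrib_mat_vec[of "t \<cdot>\<^sub>m 1\<^sub>m n" n n A v]
      by (simp add: R_def smult_mat_mult_vec[of _ n n])
    then show ?thesis using that A by simp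
  qed
  have cA: "cmat A \<in> carrier_mat n n" using A by simp
  obtain \<mu> where "eigenvalue (cmat A) \<mu>" and \<mu>: "cmod \<mu> = \<rho>"
    using spectral_radius_mem_max(1)[OF cA n] by (auto simp: spectrum_def \<rho>_def)
  then obtain v where v: "v \<in> carrier_vec n" "v \<noteq> 0\<^sub>v n" "cmat A *\<^sub>v v = \<mu> \<cdot>\<^sub>v v"
    using A by (auto simp: eigenvalue_def eigenvector_def)
  define x where "x = map_vec cmod v"
  have x: "x \<in> carrier_vec n" using v by (simp add: x_def)
  define u where "u = - (R \<rho> *\<^sub>v x)"
  have u: "u \<in> carrier_vec n" using mult_mat_vec_carrier[OF R x] by (simp add: u_def)
  \<comment> \<open>The triangle inequality applied to row \<open>i\<close> of the eigenvector
    equation.\<close>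
  have u0: "0 \<le> u $ i" if "i < n" for i
  proof -
    have "\<rho> * x $ i = cmod ((cmat A *\<^sub>v v) $ i)"
      using v \<mu> that by (simp add: x_def norm_mult)
    also have "(cmat A *\<^sub>v v) $ i = (\<Sum>j = 0..<n. of_real (A $$ (i, j)) * v $ j)"
      using that A v(1) index_mult_mat_vec_sum[OF cA v(1) that] by simp
    also have "cmod \<dots> \<le> (\<Sum>j = 0..<n. cmod (of_real (A $$ (i, j)) * v $ j))"
      by (rule norm_sum)
    also have "\<dots> = (\<Sum>j = 0..<n. A $$ (i, j) * x $ j)"
      using that v nonneg by (intro sum.cong) (auto simp: x_def norm_mult)
    also have "\<dots> = (A *\<^sub>v x) $ i"
      using that A x by (simp del: index_mult_mat_vec add: index_mult_mat_vec_sum[of _ n n])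
    finally show ?thesis
      using R_mult[OF x that, of \<rho>] that carrier_matD(1)[OF R, of \<rho>] by (simp add: u_def)
  qed
  have x_le: "0 \<le> - x $ i" if i: "i < n" for i
  proof -
    \<comment> \<open>Cramer's rule gives the \<open>i\<close>-th coordinate of the solution as a
      function of \<open>t\<close> that is continuous wherever the determinant does not vanish, in
      particular at \<rho>.\<close>
    define q where "q = (\<lambda>t. det (replace_col (R t) u i) / det (R t))"
    have q: "y $ i = q t" if "y \<in> carrier_vec n" "R t *\<^sub>v y = u" "det (R t) \<noteq> 0" for y t
      using cramer_lemma_mat[OF R that(1) i, of t] that by (simp add: q_def)
    have q0: "0 \<le> q t" if t: "\<rho> < t" for t
    proof -
      have "\<not> eigenvalue (cmat A) (of_real t)"
      proof
        assume "eigenvalue (cmat A) (of_real t)"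
        then have "cmod (of_real t) \<le> \<rho>"
          unfolding \<rho>_def by (intro norm_eigenvalue_le_spectral_radius[OF cA])
        then show False using t by simp
      qed
      then have det: "det (R t) \<noteq> 0"
        using eigenvalue_cmat_of_real[OF A] by (simp add: R_def)
      \<comment> \<open>The adjugate provides the solution explicitly. As
        \<open>t * y - A y = u\<close> is nonnegative, \<open>nonneg_if_mult_le\<close> applies to
        it.\<close>
      define y where "y = inverse (det (R t)) \<cdot>\<^sub>v (adj_mat (R t) *\<^sub>v u)"
      have y: "y \<in> carrier_vec n" using mult_mat_vec_carrier[OF adj_mat(1)[OF R] u] by (simp add: y_def)
      have "R t *\<^sub>v y = inverse (det (R t)) \<cdot>\<^sub>v ((R t * adj_mat (R t)) *\<^sub>v u)"
        using mult_mat_vec[OF R mult_mat_vec_carrier[OF adj_mat(1)[OF R] u], of t]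
          assoc_mult_mat_vec[OF R adj_mat(1)[OF R] u] by (simp add: y_def)
      also have "\<dots> = u"
        using det u by (simp add: adj_mat(2)[OF R] smult_mat_mult_vec[of _ n n] smult_smult_assoc)
      finally have Ry: "R t *\<^sub>v y = u" .
      have "0 \<le> y $ i"
        using R_mult[OF y, of _ t] u0 Ry t
        by (intro nonneg_if_mult_le[OF A nonneg _ y _ i, of t]) (fastforce simp: \<rho>_def)+
      then show ?thesis using q[OF y Ry det] by simp
    qed
    have "continuous_on UNIV (\<lambda>t. det (R t))"
      using A by (intro continuous_on_det R)
        (auto simp: R_def intro!: continuous_on_mult continuous_on_diff continuous_on_id continuous_on_const)
    moreover have "continuous_on UNIV (\<lambda>t. det (replace_col (R t) u i))"
    proof (intro continuous_on_det)
      show "replace_col (R t) u i \<in> carrier_mat n n" for t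
        using R[of t] by (auto simp: replace_col_def)
      show "continuous_on UNIV (\<lambda>t. replace_col (R t) u i $$ (k, l))" if "k < n" "l < n" for k l
        using A that by (cases "l = i")
          (auto simp: replace_col_def R_def intro!: continuous_on_mult continuous_on_diff continuous_on_id continuous_on_const)
    qed
    ultimately have "isCont q \<rho>"
      unfolding q_def using det\<rho>
      by (intro isCont_divide) (auto simp: continuous_on_eq_continuous_at)
    then have "(q \<longlongrightarrow> q \<rho>) (at_right \<rho>)"
      by (auto simp: isCont_def intro: tendsto_within_subset)
    moreover have "\<forall>\<^sub>F t in at_right \<rho>. 0 \<le> q t"
      using q0 eventually_at_right_less by (rule eventually_mono[rotated])
    ultimately have "0 \<le> q \<rho>"
      by (intro tendsto_lowerbound) auto
    moreover have "(- x) $ i = q \<rho>"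
    proof (rule q[OF _ _ det\<rho>])
      show "- x \<in> carrier_vec n" using x by simp
      show "R \<rho> *\<^sub>v - x = u"
        using carrier_matD[OF R, of \<rho>] x by (intro eq_vecI) (auto simp: u_def)
    qed
    ultimately show ?thesis using i x by simp
  qed
  have "v = 0\<^sub>v n"
    using v(1) x_le by (intro eq_vecI) (auto simp: x_def)
  then show False using v by simp
qed

section \<open>The peripheral spectrum of matrices with nonnegative minors\<close>

lemma linear_order_on_finite_has_max:
  assumes lin: "linear_order_on X W" and M: "finite M" "M \<noteq> {}" "M \<subseteq> X"
  shows "\<exists>m\<in>M. \<forall>x\<in>M. (x, m) \<in> W"
  using M
proof (induction rule: finite_ne_induct)
  case (singleton x)
  then show ?case
    using lin by (auto simp: order_on_defs refl_on_def)
next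
  case (insert x F)
  then obtain m where m: "m \<in> F" "\<forall>y\<in>F. (y, m) \<in> W" by auto
  have "trans W" "(x, x) \<in> W" and total: "x = m \<or> (x, m) \<in> W \<or> (m, x) \<in> W"
    using lin insert.prems m by (auto simp: order_on_defs refl_on_def total_on_def)
  from total show ?case
  proof (elim disjE)
    assume "(m, x) \<in> W"
    then have "\<forall>y\<in>insert x F. (y, x) \<in> W"
      using m \<open>trans W\<close> \<open>(x, x) \<in> W\<close> by (blast dest: transD)
    then show ?thesis by blast
  qed (use m \<open>(x, x) \<in> W\<close> in auto)
qed

text \<open>If \<open>m\<close> is the largest index and \<open>p k = m\<close>, then the minor in the rows \<open>k, m\<close> and the columns \<open>p m, m\<close>
  allows to replace \<open>k \<mapsto> m \<mapsto> p m\<close> by the fixed point \<open>m\<close> and \<open>k \<mapsto> p m\<close>.\<close>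

lemma prod_permutes_le_prod_diag:
  fixes b :: "'a \<Rightarrow> 'a \<Rightarrow> real"
  assumes lin: "linear_order_on X W"
    and nonneg: "\<And>i j. i \<in> X \<Longrightarrow> j \<in> X \<Longrightarrow> 0 \<le> b i j"
    and minors: "\<And>i j k l. (i, j) \<in> W \<Longrightarrow> (k, l) \<in> W \<Longrightarrow> b i l * b j k \<le> b i k * b j l"
    and M: "finite M" "M \<subseteq> X" and p: "p permutes M"
  shows "(\<Prod>i\<in>M. b i (p i)) \<le> (\<Prod>i\<in>M. b i i)"
  using M p
proof (induction M arbitrary: p rule: finite_psubset_induct)
  case (psubset M)
  note p = \<open>p permutes M\<close>
  show ?case
  proof (cases "M = {}")
    case True
    then show ?thesis by simp
  next
    case False
    then obtain m where m: "m \<in> M" "\<forall>x\<in>M. (x, m) \<in> W"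
      using linear_order_on_finite_has_max[OF lin psubset.hyps False psubset.prems(1)] by blast
    define k where "k = inv_into UNIV p m"
    have k: "k \<in> M" "p k = m" "p m \<in> M"
      using m p by (auto simp: k_def permutes_in_image permutes_inv)
    have p_eq: "p i = m \<longleftrightarrow> i = k" for i
      using k permutes_inj[OF p] by (metis injD)
    define q where "q = transpose m (p m) \<circ> p"
    have qm: "q m = m" by (simp add: q_def)
    have qk: "q k = p m" by (simp add: q_def k)
    have q_other: "q i = p i" if "i \<noteq> m" "i \<noteq> k" for i
      using that p_eq permutes_inj[OF p] by (auto simp: q_def transpose_def dest: injD)
    have "q permutes M"
      unfolding q_def using m k p by (intro permutes_compose permutes_swap_id)
    then have q: "q permutes M - {m}"
      using qm by (auto intro: permutes_superset)
    have le: "(\<Prod>i\<in>M. b i (p i)) \<le> b m m * (\<Prod>i\<in>M - {m}. b i (q i))"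
    proof (cases "k = m")
      case True
      then have "(\<Prod>i\<in>M - {m}. b i (p i)) = (\<Prod>i\<in>M - {m}. b i (q i))"
        using q_other by (intro prod.cong) auto
      then show ?thesis
        using True k prod.remove[OF \<open>finite M\<close> m(1), of "\<lambda>i. b i (p i)"] by simp
    next
      case False
      have k': "k \<in> M - {m}" using k False by simp
      define P where "P = (\<Prod>i\<in>M - {m} - {k}. b i (p i))"
      have P: "P = (\<Prod>i\<in>M - {m} - {k}. b i (q i))"
        unfolding P_def using q_other by (intro prod.cong) auto
      have "0 \<le> P"
        unfolding P_def using psubset.prems p
        by (intro prod_nonneg) (auto intro!: nonneg simp: permutes_in_image)
      have "(\<Prod>i\<in>M. b i (p i)) = b m (p m) * (b k m * P)"
        using prod.remove[OF \<open>finite M\<close> m(1), of "\<lambda>i. b i (p i)"]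
          prod.remove[OF _ k', of "\<lambda>i. b i (p i)"] \<open>finite M\<close> k by (simp add: P_def)
      also have "\<dots> = (b k m * b m (p m)) * P" by simp
      also have "\<dots> \<le> (b k (p m) * b m m) * P"
        using m k \<open>0 \<le> P\<close> by (intro mult_right_mono minors) auto
      also have "\<dots> = b m m * (\<Prod>i\<in>M - {m}. b i (q i))"
        using prod.remove[OF _ k', of "\<lambda>i. b i (q i)"] \<open>finite M\<close> by (simp add: P qk)
      finally show ?thesis .
    qed
    also have "\<dots> \<le> b m m * (\<Prod>i\<in>M - {m}. b i i)"
      using m psubset.prems q
      by (intro mult_left_mono psubset.IH nonneg) auto
    also have "\<dots> = (\<Prod>i\<in>M. b i i)"
      using prod.remove[OF \<open>finite M\<close> m(1), of "\<lambda>i. b i i"] by simp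
    finally show ?thesis .
  qed
qed

text \<open>Compare Leibniz summands. A permutation moving a point of \<open>Z\<close> contributes 0
  to both determinants; for any other one the summands differ only by \<open>x\<close> against
  \<open>y\<close> at the points of \<open>Z\<close>. Cross-multiplication avoids division, as
  \<open>x\<close> or \<open>y\<close> may vanish.\<close>

lemma det_diagonal_exchange:
  fixes M M' :: "'a :: comm_ring_1 mat"
  assumes M: "M \<in> carrier_mat n n" "M' \<in> carrier_mat n n" and Z: "Z \<subseteq> {0..<n}"
    and diag: "\<And>i. i \<in> Z \<Longrightarrow> M $$ (i, i) = x" "\<And>i. i \<in> Z \<Longrightarrow> M' $$ (i, i) = y"
    and eq: "\<And>i j. i < n \<Longrightarrow> j < n \<Longrightarrow> i \<noteq> j \<or> i \<notin> Z \<Longrightarrow> M' $$ (i, j) = M $$ (i, j)"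
    and zero: "\<And>p z. p permutes {0..<n} \<Longrightarrow> z \<in> Z \<Longrightarrow> p z \<noteq> z \<Longrightarrow> \<exists>i<n. p i \<noteq> i \<and> M $$ (i, p i) = 0"
  shows "det M' * x ^ card Z = det M * y ^ card Z"
proof -
  have "(\<Prod>i = 0..<n. M' $$ (i, p i)) * x ^ card Z = (\<Prod>i = 0..<n. M $$ (i, p i)) * y ^ card Z"
    if p: "p permutes {0..<n}" for p
  proof (cases "\<exists>z\<in>Z. p z \<noteq> z")
    case True
    then obtain i where i: "i < n" "p i \<noteq> i" "M $$ (i, p i) = 0" using zero[OF p] by auto
    then have "M' $$ (i, p i) = 0"
      using eq[of i "p i"] permutes_in_image[OF p, of i] by auto
    with i have "(\<Prod>i = 0..<n. M $$ (i, p i)) = 0" "(\<Prod>i = 0..<n. M' $$ (i, p i)) = 0"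
      by (auto intro!: prod_zero bexI[of _ i])
    then show ?thesis by simp
  next
    case False
    have "(\<Prod>i = 0..<n. f i (p i)) = (\<Prod>i\<in>{0..<n} - Z. f i (p i)) * (\<Prod>i\<in>Z. f i i)"
      for f :: "nat \<Rightarrow> nat \<Rightarrow> 'a"
      using prod.subset_diff[OF Z, of "\<lambda>i. f i (p i)"] False by simp
    from this[of "\<lambda>i j. M $$ (i, j)"] this[of "\<lambda>i j. M' $$ (i, j)"]
    have "(\<Prod>i = 0..<n. M $$ (i, p i)) = (\<Prod>i\<in>{0..<n} - Z. M $$ (i, p i)) * x ^ card Z"
      "(\<Prod>i = 0..<n. M' $$ (i, p i)) = (\<Prod>i\<in>{0..<n} - Z. M' $$ (i, p i)) * y ^ card Z"
      using diag by simp_all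
    moreover have "(\<Prod>i\<in>{0..<n} - Z. M' $$ (i, p i)) = (\<Prod>i\<in>{0..<n} - Z. M $$ (i, p i))"
      using permutes_in_image[OF p] by (intro prod.cong) (auto intro!: eq)
    ultimately show ?thesis by (simp add: mult_ac)
  qed
  then show ?thesis
    unfolding det_def'[OF M(1)] det_def'[OF M(2)] sum_distrib_right
    by (intro sum.cong) (auto simp: mult.assoc)
qed

lemma peripheral_eigenvalue_unique:
  fixes B :: "real mat"
  assumes B: "B \<in> carrier_mat n n" and lin: "linear_order_on {..<n} W"
    and nonneg: "\<And>i j. i < n \<Longrightarrow> j < n \<Longrightarrow> 0 \<le> B $$ (i, j)"
    and minors: "\<And>i j k l. (i, j) \<in> W \<Longrightarrow> (k, l) \<in> W \<Longrightarrow>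
                   B $$ (i, l) * B $$ (j, k) \<le> B $$ (i, k) * B $$ (j, l)"
    and e: "eigenvalue (cmat B) e" "cmod e = spectral_radius (cmat B)"
  shows "e = of_real (spectral_radius (cmat B))"
proof (cases "e = 0")
  case True
  then show ?thesis using e by simp
next
  case False
  define \<rho> where "\<rho> = spectral_radius (cmat B)"
  define Z where "Z = {i. i < n \<and> B $$ (i, i) = 0}"
  \<comment> \<open>The smallest nonzero diagonal entry, capped at 1; the inserted 1 also makes the
    minimum meaningful when the whole diagonal vanishes.\<close>
  define \<delta> where "\<delta> = Min (insert 1 {B $$ (i, i) |i. i < n \<and> B $$ (i, i) \<noteq> 0})"
  have fin: "finite {B $$ (i, i) |i. i < n \<and> B $$ (i, i) \<noteq> 0}" by simp
  have \<delta>0: "0 < \<delta>"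
    unfolding \<delta>_def using fin nonneg by (subst Min_gr_iff) (auto simp: order_less_le)
  have \<delta>_le: "\<delta> \<le> B $$ (i, i)" if "i < n" "B $$ (i, i) \<noteq> 0" for i
    unfolding \<delta>_def using fin that by (intro Min_le) auto
  \<comment> \<open>Zero diagonal entries are left alone so that \<open>N\<close> stays nonnegative;
    \<open>N\<close> is therefore not quite a shift of \<open>B\<close>, and \<open>shift\<close>
    repairs this.\<close>
  define N where "N = mat n n (\<lambda>(i, j). if i = j \<and> i \<notin> Z then B $$ (i, j) - \<delta> else B $$ (i, j))"
  have N: "N \<in> carrier_mat n n" by (simp add: N_def)
  have N0: "0 \<le> N $$ (i, j)" if "i < n" "j < n" for i j
    using that nonneg[OF that] \<delta>_le by (auto simp: N_def Z_def)
  have n: "0 < n"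
    using eigenvalue_imp_nonzero_dim[OF _ e(1)] B by auto
  have zero: "\<exists>i<n. p i \<noteq> i \<and> B $$ (i, p i) = 0"
    if p: "p permutes {0..<n}" and z: "z \<in> Z" "p z \<noteq> z" for p z
  proof -
    \<comment> \<open>Only the moved points are kept: the uncrossing inequality then bounds a
      product of off-diagonal entries by one containing \<open>B $$ (z, z) = 0\<close>.\<close>
    define S where "S = {i. i < n \<and> p i \<noteq> i}"
    have "p permutes S"
      using p by (rule permutes_superset) (auto simp: S_def)
    then have "(\<Prod>i\<in>S. B $$ (i, p i)) \<le> (\<Prod>i\<in>S. B $$ (i, i))"
      using nonneg minors by (intro prod_permutes_le_prod_diag[OF lin]) (auto simp: S_def)
    also have "\<dots> = 0"
      using z by (intro prod_zero) (auto simp: S_def Z_def)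
    finally have "(\<Prod>i\<in>S. B $$ (i, p i)) = 0"
      using nonneg permutes_in_image[OF p]
      by (intro antisym prod_nonneg) (auto simp: S_def)
    then show ?thesis by (auto simp: S_def)
  qed
  \<comment> \<open>The two characteristic matrices agree except on the diagonal over
    \<open>Z\<close>, where they carry \<delta> - c and -c. Hence the spectra of \<open>N\<close>
    and \<open>B\<close> correspond under translation by \<delta>, up to the exceptional value
    \<open>c = 0\<close> in each direction.\<close>
  have shift: "det (char_matrix (cmat N) (c - of_real \<delta>)) * (- c) ^ card Z =
               det (char_matrix (cmat B) c) * (of_real \<delta> - c) ^ card Z" for c
  proof (rule det_diagonal_exchange)
    fix p z assume "p permutes {0..<n}" "z \<in> Z" "p z \<noteq> z"
    from zero[OF this] obtain i where i: "i < n" "p i \<noteq> i" "B $$ (i, p i) = 0" by auto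
    moreover have "p i < n"
      using permutes_in_image[OF \<open>p permutes {0..<n}\<close>, of i] i by simp
    ultimately show "\<exists>i<n. p i \<noteq> i \<and> char_matrix (cmat B) c $$ (i, p i) = 0"
      using B by (intro exI[of _ i]) (simp add: char_matrix_def)
  qed (use B in \<open>auto simp: N_def Z_def char_matrix_def\<close>)
  have cB: "cmat B \<in> carrier_mat n n" and cN: "cmat N \<in> carrier_mat n n" using B N by auto
  have to_N: "eigenvalue (cmat N) (c - of_real \<delta>)" if "eigenvalue (cmat B) c" "c \<noteq> 0" for c
    using that shift[of c] by (simp add: eigenvalue_det[OF cB] eigenvalue_det[OF cN])
  have to_B: "eigenvalue (cmat B) (c + of_real \<delta>)" if "eigenvalue (cmat N) c" "c \<noteq> 0" for c
    using that shift[of "c + of_real \<delta>"] by (simp add: eigenvalue_det[OF cB] eigenvalue_det[OF cN])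
  define \<sigma> where "\<sigma> = spectral_radius (cmat N)"
  have \<sigma>: "eigenvalue (cmat N) (of_real \<sigma>)" "0 \<le> \<sigma>"
    unfolding \<sigma>_def
    using nonneg_mat_eigenvalue_spectral_radius[OF N N0 n] spectral_radius_nonneg[OF cN n] by auto
  have e\<sigma>: "cmod (e - of_real \<delta>) \<le> \<sigma>"
    unfolding \<sigma>_def by (rule norm_eigenvalue_le_spectral_radius[OF cN to_N[OF e(1) False]])
  show ?thesis
  proof (cases "\<sigma> = 0")
    \<comment> \<open>The value 0 is excluded in \<open>to_B\<close>, but here the disc of radius 0
      leaves only the positive number \<delta> for \<open>e\<close>.\<close>
    case True
    then have "e = of_real \<delta>" using e\<sigma> by simp
    then show ?thesis using e(2) \<delta>0 by simp
  next
    case False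
    then have "eigenvalue (cmat B) (of_real (\<sigma> + \<delta>))"
      using to_B[OF \<sigma>(1)] by simp
    from norm_eigenvalue_le_spectral_radius[OF cB this]
    have "\<sigma> + \<delta> \<le> \<rho>"
      using \<sigma> \<delta>0 by (simp add: \<rho>_def del: of_real_add)
    \<comment> \<open>The disc around \<delta> of radius \<rho> - \<delta> touches the circle of
      radius \<rho> only at \<rho>; comparing squares yields this as a bound on
      \<open>Re e\<close>.\<close>
    then have "(cmod (e - of_real \<delta>))\<^sup>2 \<le> (\<rho> - \<delta>)\<^sup>2"
      using e\<sigma> by (intro power_mono) auto
    moreover have "(cmod e)\<^sup>2 = \<rho>\<^sup>2" using e by (simp add: \<rho>_def)
    ultimately have "\<delta> * \<rho> \<le> \<delta> * Re e"
      unfolding cmod_power2 by (simp add: power2_eq_square algebra_simps)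
    then have "\<rho> \<le> Re e" using \<delta>0 by simp
    moreover have "Re e \<le> \<rho>" using complex_Re_le_cmod[of e] e by (simp add: \<rho>_def)
    ultimately have re: "Re e = \<rho>" by simp
    then have "Im e = 0"
      using \<open>(cmod e)\<^sup>2 = \<rho>\<^sup>2\<close> unfolding cmod_power2 by simp
    with re show ?thesis by (simp add: complex_eq_iff \<rho>_def)
  qed
qed

section \<open>Eigenvalues of the second compound\<close>

lemma sum_lex_pairs: "(\<Sum>q<n choose 2. f (lex_pairs n ! q)) = (\<Sum>p | fst p < snd p \<and> snd p < n. f p)"
proof -
  have "bij_betw ((!) (lex_pairs n)) {..<n choose 2} {p. fst p < snd p \<and> snd p < n}"
    by (rule bij_betw_nth) (auto simp: distinct_lex_pairs length_lex_pairs set_lex_pairs)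
  then show ?thesis by (rule sum.reindex_bij_betw)
qed

lemma sum_square_eq_sum_pairs:
  fixes g :: "nat \<Rightarrow> nat \<Rightarrow> 'a :: comm_monoid_add"
  assumes "\<And>k. k < n \<Longrightarrow> g k k = 0"
  shows "(\<Sum>k<n. \<Sum>l<n. g k l) = (\<Sum>p | fst p < snd p \<and> snd p < n. g (fst p) (snd p) + g (snd p) (fst p))"
proof -
  define P where "P = {p :: nat \<times> nat. fst p < snd p \<and> snd p < n}"
  have fin: "finite P" by (rule finite_subset[of _ "{..<n} \<times> {..<n}"]) (auto simp: P_def)
  have "(\<Sum>k<n. \<Sum>l<n. g k l) = (\<Sum>p\<in>{..<n} \<times> {..<n}. g (fst p) (snd p))"
    by (simp add: sum.cartesian_product case_prod_unfold)
  also have "\<dots> = (\<Sum>p\<in>P \<union> prod.swap ` P. g (fst p) (snd p))"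
  proof (rule sum.mono_neutral_right)
    show "P \<union> prod.swap ` P \<subseteq> {..<n} \<times> {..<n}" by (auto simp: P_def)
    have "k = l" if "k < n" "l < n" "(k, l) \<notin> P \<union> prod.swap ` P" for k l
    proof (rule ccontr)
      assume "k \<noteq> l"
      then have "(k, l) \<in> P \<or> (l, k) \<in> P" using that by (auto simp: P_def)
      then show False using that by (metis UnI1 UnI2 image_eqI swap_simp)
    qed
    then show "\<forall>p\<in>{..<n} \<times> {..<n} - (P \<union> prod.swap ` P). g (fst p) (snd p) = 0"
      using assms by (metis DiffE mem_Sigma_iff lessThan_iff prod.collapse)
  qed simp
  also have "\<dots> = (\<Sum>p\<in>P. g (fst p) (snd p)) + (\<Sum>p\<in>prod.swap ` P. g (fst p) (snd p))"
    using fin by (intro sum.union_disjoint) (auto simp: P_def)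
  also have "(\<Sum>p\<in>prod.swap ` P. g (fst p) (snd p)) = (\<Sum>p\<in>P. g (snd p) (fst p))"
    by (subst sum.reindex) (auto simp: inj_on_def)
  finally show ?thesis by (simp add: sum.distrib P_def)
qed

lemma lex_pairs_nth_less:
  assumes "p < n choose 2" "lex_pairs n ! p = (i, j)"
  shows "i < j" "j < n"
  using nth_mem[of p "lex_pairs n"] assms by (auto simp: length_lex_pairs set_lex_pairs)

lemma lex_number_nth:
  assumes "p < n choose 2" "lex_pairs n ! p = (i, j)"
  shows "lex_number n i j = p"
  using lex_number_less nth_lex_number lex_pairs_nth_less[OF assms] assms
  by (metis distinct_lex_pairs length_lex_pairs nth_eq_iff_index_eq)

text \<open>The action of the second compound on bivectors: an alternating \<open>W\<close> is mapped to \<open>A W A\<^sup>T\<close>.\<close>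

lemma second_compound_mult_alternating:
  fixes A :: "'a :: comm_ring_1 mat"
  assumes A: "A \<in> carrier_mat n n"
    and W: "\<And>k. k < n \<Longrightarrow> W k k = 0" "\<And>k l. k < n \<Longrightarrow> l < n \<Longrightarrow> W l k = - W k l"
    and p: "p < n choose 2" "lex_pairs n ! p = (i, j)"
  shows "(second_compound A *\<^sub>v vec (n choose 2) (\<lambda>q. case_prod W (lex_pairs n ! q))) $ p =
         (\<Sum>k<n. \<Sum>l<n. A $$ (i, k) * W k l * A $$ (j, l))"
proof -
  have "(second_compound A *\<^sub>v vec (n choose 2) (\<lambda>q. case_prod W (lex_pairs n ! q))) $ p =
        (\<Sum>q<n choose 2. minor2 A (i, j) (lex_pairs n ! q) * case_prod W (lex_pairs n ! q))"
    using A p by (auto simp: second_compound_def Let_def scalar_prod_def atLeast0LessThan intro!: sum.cong)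
  also have "\<dots> = (\<Sum>q | fst q < snd q \<and> snd q < n. minor2 A (i, j) q * case_prod W q)"
    by (rule sum_lex_pairs)
  also have "\<dots> = (\<Sum>q | fst q < snd q \<and> snd q < n.
      A $$ (i, fst q) * W (fst q) (snd q) * A $$ (j, snd q)
      + A $$ (i, snd q) * W (snd q) (fst q) * A $$ (j, fst q))"
    by (rule sum.cong) (auto simp: minor2_def W(2)[of "fst _" "snd _"] algebra_simps)
  also have "\<dots> = (\<Sum>k<n. \<Sum>l<n. A $$ (i, k) * W k l * A $$ (j, l))"
    using W(1) by (subst sum_square_eq_sum_pairs) auto
  finally show ?thesis .
qed

text \<open>The exterior product of the two eigenvectors is an eigenvector of the compound; it is
  nonzero because eigenvectors to distinct eigenvalues are independent.\<close>

lemma eigenvalue_second_compound_mult: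
  fixes A :: "'a :: field mat"
  assumes A: "A \<in> carrier_mat n n" and ev: "eigenvalue A a" "eigenvalue A b" and "a \<noteq> b"
  shows "eigenvalue (second_compound A) (a * b)"
proof -
  obtain v where v: "v \<in> carrier_vec n" "v \<noteq> 0\<^sub>v n" "A *\<^sub>v v = a \<cdot>\<^sub>v v"
    using ev(1) A by (auto simp: eigenvalue_def eigenvector_def)
  obtain w where w: "w \<in> carrier_vec n" "w \<noteq> 0\<^sub>v n" "A *\<^sub>v w = b \<cdot>\<^sub>v w"
    using ev(2) A by (auto simp: eigenvalue_def eigenvector_def)
  have Av: "(\<Sum>k<n. A $$ (i, k) * v $ k) = a * v $ i" if "i < n" for i
    using arg_cong[OF v(3), of "\<lambda>x. x $ i"] that A v(1) by (simp add: scalar_prod_def atLeast0LessThan)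
  have Aw: "(\<Sum>k<n. A $$ (i, k) * w $ k) = b * w $ i" if "i < n" for i
    using arg_cong[OF w(3), of "\<lambda>x. x $ i"] that A w(1) by (simp add: scalar_prod_def atLeast0LessThan)
  define W where "W k l = v $ k * w $ l - v $ l * w $ k" for k l
  define \<omega> where "\<omega> = vec (n choose 2) (\<lambda>q. case_prod W (lex_pairs n ! q))"
  have \<omega>: "\<omega> \<in> carrier_vec (n choose 2)" by (simp add: \<omega>_def)
  have "(second_compound A *\<^sub>v \<omega>) $ p = (a * b) * \<omega> $ p" if p: "p < n choose 2" for p
  proof -
    obtain i j where ij: "lex_pairs n ! p = (i, j)" by fastforce
    note less = lex_pairs_nth_less[OF p ij]
    have "(second_compound A *\<^sub>v \<omega>) $ p = (\<Sum>k<n. \<Sum>l<n. A $$ (i, k) * W k l * A $$ (j, l))"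
      unfolding \<omega>_def by (rule second_compound_mult_alternating[OF A _ _ p ij]) (auto simp: W_def)
    also have "\<dots> = (\<Sum>k<n. A $$ (i, k) * v $ k) * (\<Sum>l<n. A $$ (j, l) * w $ l)
        - (\<Sum>k<n. A $$ (i, k) * w $ k) * (\<Sum>l<n. A $$ (j, l) * v $ l)"
      unfolding W_def sum_product sum_subtractf[symmetric]
      by (intro sum.cong refl) (simp add: algebra_simps)
    also have "\<dots> = (a * v $ i) * (b * w $ j) - (b * w $ i) * (a * v $ j)"
      using less by (simp only: Av Aw order.strict_trans[OF less])
    also have "\<dots> = (a * b) * W i j"
      by (simp add: W_def algebra_simps)
    finally show ?thesis using p ij by (simp add: \<omega>_def)
  qed
  then have "second_compound A *\<^sub>v \<omega> = (a * b) \<cdot>\<^sub>v \<omega>"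
    using second_compound_carrier[OF A] \<omega> by (intro eq_vecI) auto
  moreover have "\<omega> \<noteq> 0\<^sub>v (n choose 2)"
  proof
    \<comment> \<open>If all coordinates of the exterior product vanish, \<open>w\<close> is a
      multiple of \<open>v\<close> and so belongs to both eigenvalues \<open>a\<close> and
      \<open>b\<close>.\<close>
    assume 0: "\<omega> = 0\<^sub>v (n choose 2)"
    have W_less: "W k l = 0" if "k < l" "l < n" for k l
    proof -
      have "\<omega> $ lex_number n k l = 0" using 0 lex_number_less[OF that] by simp
      then show ?thesis using lex_number_less[OF that] nth_lex_number[OF that] by (simp add: \<omega>_def)
    qed
    have W0: "W k l = 0" if "k < n" "l < n" for k l
    proof -
      have "W l k = - W k l" "W k k = 0" by (auto simp: W_def)
      then show ?thesis using W_less[of k l] W_less[of l k] that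
        by (cases k l rule: linorder_cases) auto
    qed
    obtain k where k: "k < n" "v $ k \<noteq> 0"
      using v(1,2) by (auto simp: vec_eq_iff)
    have "w = (w $ k / v $ k) \<cdot>\<^sub>v v"
      using v w k W0[of k] by (intro eq_vecI) (auto simp: W_def field_simps)
    then have "A *\<^sub>v w = (w $ k / v $ k) \<cdot>\<^sub>v (A *\<^sub>v v)"
      using mult_mat_vec[OF A v(1)] by metis
    also have "\<dots> = a \<cdot>\<^sub>v w"
      using v w k W0[of k] by (intro eq_vecI) (auto simp: W_def field_simps)
    finally have eq: "b \<cdot>\<^sub>v w = a \<cdot>\<^sub>v w" using w by simp
    have "w = 0\<^sub>v n"
    proof (intro eq_vecI)
      fix l assume "l < dim_vec (0\<^sub>v n :: 'a vec)"
      then have "b * w $ l = a * w $ l" using arg_cong[OF eq, of "\<lambda>x. x $ l"] w by simp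
      then show "w $ l = 0\<^sub>v n $ l" using \<open>l < _\<close> \<open>a \<noteq> b\<close> by simp
    qed (use w in simp)
    then show False using w by simp
  qed
  ultimately show ?thesis
    using second_compound_carrier[OF A] \<omega> by (auto simp: eigenvalue_def eigenvector_def)
qed

section \<open>Eigenvalues of the compound as products of two eigenvalues\<close>

lemma index_mult_mult_transpose:
  fixes A W :: "'a :: comm_ring_1 mat"
  assumes "A \<in> carrier_mat n n" "W \<in> carrier_mat n n" "i < n" "j < n"
  shows "(A * W * A\<^sup>T) $$ (i, j) = (\<Sum>k<n. \<Sum>l<n. A $$ (i, k) * W $$ (k, l) * A $$ (j, l))"
  using assms by (simp add: scalar_prod_def atLeast0LessThan sum_distrib_left mult.assoc)

text \<open>Alternating matrices transform by congruence; composing two transformations carries the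
  eigenvector equation into the triangularizing basis and back.\<close>

lemma congruence_mult:
  fixes P Q W :: "'a :: comm_ring_1 mat"
  assumes P: "P \<in> carrier_mat n n" and Q: "Q \<in> carrier_mat n n" and W: "W \<in> carrier_mat n n"
  shows "P * Q * W * (P * Q)\<^sup>T = P * (Q * W * Q\<^sup>T) * P\<^sup>T"
proof -
  have carr: "P\<^sup>T \<in> carrier_mat n n" "Q\<^sup>T \<in> carrier_mat n n"
    "Q\<^sup>T * P\<^sup>T \<in> carrier_mat n n" "W * Q\<^sup>T \<in> carrier_mat n n" "Q * (W * Q\<^sup>T) \<in> carrier_mat n n"
    "P * Q \<in> carrier_mat n n" "Q * W \<in> carrier_mat n n" "W * (Q\<^sup>T * P\<^sup>T) \<in> carrier_mat n n"
    using assms by auto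
  show ?thesis
    by (simp only: transpose_mult[OF P Q] assoc_mult_mat[of _ n n _ n _ n] P Q W carr)
qed

text \<open>In a basis in which \<open>A\<close> is triangular, the last nonzero entry of the alternating matrix
  belonging to an eigenvector of the second compound isolates two diagonal entries of \<open>A\<close>.\<close>

lemma eigenvalue_second_compound_imp_mult:
  fixes A :: "complex mat"
  assumes A: "A \<in> carrier_mat n n" and es: "char_poly A = (\<Prod>e\<leftarrow>es. [:- e, 1:])"
    and ev: "eigenvalue (second_compound A) \<theta>"
  obtains i j where "i < n" "j < n" "i \<noteq> j" "\<theta> = es ! i * es ! j"
proof -
  obtain \<omega> where \<omega>: "\<omega> \<in> carrier_vec (n choose 2)" "\<omega> \<noteq> 0\<^sub>v (n choose 2)"
    "second_compound A *\<^sub>v \<omega> = \<theta> \<cdot>\<^sub>v \<omega>"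
    using ev carrier_matD[OF second_compound_carrier[OF A]] unfolding eigenvalue_def eigenvector_def by auto
  \<comment> \<open>The alternating extension of \<omega> to all index pairs. The eigenvector
    equation becomes \<open>A * W * A\<^sup>T = \<theta> \<cdot>\<^sub>m W\<close>, which behaves
    well under a change of basis.\<close>
  define w where "w k l = (if k < l then \<omega> $ lex_number n k l else if l < k then - \<omega> $ lex_number n l k else 0)" for k l
  have w: "w k k = 0" "w l k = - w k l" for k l by (auto simp: w_def)
  have \<omega>_eq: "\<omega> = vec (n choose 2) (\<lambda>q. case_prod w (lex_pairs n ! q))"
  proof (rule eq_vecI)
    fix p assume "p < dim_vec (vec (n choose 2) (\<lambda>q. case_prod w (lex_pairs n ! q)))"
    then have p: "p < n choose 2" by simp
    obtain i j where ij: "lex_pairs n ! p = (i, j)" by fastforce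
    show "\<omega> $ p = vec (n choose 2) (\<lambda>q. case_prod w (lex_pairs n ! q)) $ p"
      using p ij lex_number_nth[OF p ij] lex_pairs_nth_less[OF p ij] by (simp add: w_def)
  qed (use \<omega>(1) in simp)
  define W where "W = mat n n (\<lambda>(k, l). w k l)"
  have W: "W \<in> carrier_mat n n" by (simp add: W_def)
  have WT: "W\<^sup>T = - W"
    by (intro eq_matI) (auto simp: W_def intro: w(2))
  have entry_less: "(A * W * A\<^sup>T) $$ (i, j) = \<theta> * w i j" if "i < j" "j < n" for i j
  proof -
    let ?p = "lex_number n i j"
    have p: "?p < n choose 2" "lex_pairs n ! ?p = (i, j)"
      using lex_number_less[OF that] nth_lex_number[OF that] by auto
    have "(A * W * A\<^sup>T) $$ (i, j) = (\<Sum>k<n. \<Sum>l<n. A $$ (i, k) * w k l * A $$ (j, l))"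
      using that by (subst index_mult_mult_transpose[OF A W]) (auto simp: W_def)
    also have "\<dots> = (second_compound A *\<^sub>v \<omega>) $ ?p"
      unfolding \<omega>_eq by (rule second_compound_mult_alternating[OF A w p, symmetric])
    also have "\<dots> = \<theta> * w i j"
      using \<omega> p that by (simp add: w_def)
    finally show ?thesis .
  qed
  have AWT: "(A * W * A\<^sup>T)\<^sup>T = - (A * W * A\<^sup>T)"
  proof -
    have "(A * W * A\<^sup>T)\<^sup>T = A * (W\<^sup>T * A\<^sup>T)"
      using A W by (simp add: transpose_mult[of _ n n _ n])
    then show ?thesis using A W by (simp add: WT)
  qed
  have swap: "(A * W * A\<^sup>T) $$ (j, i) = - (A * W * A\<^sup>T) $$ (i, j)" if "i < n" "j < n" for i j
    using arg_cong[OF AWT, of "\<lambda>M. M $$ (i, j)"] that A W by simp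
  have AWA: "A * W * A\<^sup>T = \<theta> \<cdot>\<^sub>m W"
  proof (rule eq_matI)
    fix i j assume "i < dim_row (\<theta> \<cdot>\<^sub>m W)" "j < dim_col (\<theta> \<cdot>\<^sub>m W)"
    then have ij: "i < n" "j < n" using W by auto
    have "(A * W * A\<^sup>T) $$ (i, j) = \<theta> * w i j"
    proof (cases i j rule: linorder_cases)
      case less
      then show ?thesis using entry_less ij by simp
    next
      case equal
      then have "(A * W * A\<^sup>T) $$ (i, j) = - (A * W * A\<^sup>T) $$ (i, j)" using swap[of i i] ij by simp
      then have "(A * W * A\<^sup>T) $$ (i, j) = 0" by (simp only: complex_eq_iff) simp
      then show ?thesis using equal w(1) by simp
    next
      case greater
      then show ?thesis using swap[OF ij(2,1)] entry_less[OF greater ij(1)] w(2)[of i j] by simp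
    qed
    then show "(A * W * A\<^sup>T) $$ (i, j) = (\<theta> \<cdot>\<^sub>m W) $$ (i, j)"
      using ij by (simp add: W_def)
  qed (use A W in auto)
  \<comment> \<open>The triangular form has the given list \<open>es\<close> on its diagonal in this
    very order, so positions in \<open>es\<close> are diagonal positions of
    \<open>T\<close>.\<close>
  obtain T P Q where schur: "schur_decomposition A es = (T, P, Q)"
    by (cases "schur_decomposition A es") auto
  from schur_decomposition[OF A es schur]
  have wit: "similar_mat_wit A T P Q" and tri: "upper_triangular T" and diag: "diag_mat T = es" by auto
  note witD = similar_mat_witD2[OF A wit]
  note carr = witD(5-7)
  have QA: "Q * A = T * Q"
  proof -
    have "Q * A = Q * (P * (T * Q))"
      using witD(3) carr by simp
    also have "\<dots> = (Q * P) * (T * Q)"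
      using carr by (intro assoc_mult_mat[symmetric]) auto
    finally show ?thesis using witD(2) carr by simp
  qed
  define V where "V = Q * W * Q\<^sup>T"
  have V: "V \<in> carrier_mat n n" using carr W by (simp add: V_def)
  have "T * V * T\<^sup>T = (T * Q) * W * (T * Q)\<^sup>T"
    unfolding V_def by (rule congruence_mult[OF carr(1,3) W, symmetric])
  also have "\<dots> = Q * (A * W * A\<^sup>T) * Q\<^sup>T"
    unfolding QA[symmetric] by (rule congruence_mult[OF carr(3) A W])
  also have "\<dots> = \<theta> \<cdot>\<^sub>m V"
    unfolding AWA V_def mult_smult_distrib[OF carr(3) W]
    using carr W by (intro mult_smult_assoc_mat[of _ n n _ n]) auto
  finally have TVT: "T * V * T\<^sup>T = \<theta> \<cdot>\<^sub>m V" .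
  have "V\<^sup>T = Q * (W\<^sup>T * Q\<^sup>T)"
    using carr W by (simp add: V_def transpose_mult[of _ n n _ n])
  then have VT: "V\<^sup>T = - V"
    using carr W by (simp add: V_def WT)
  have V_diag: "V $$ (i, i) = 0" if "i < n" for i
  proof -
    have "V $$ (i, i) = - V $$ (i, i)"
      using arg_cong[OF VT, of "\<lambda>M. M $$ (i, i)"] that V by simp
    then show ?thesis by (simp only: complex_eq_iff) simp
  qed
  \<comment> \<open>Congruence by \<open>P\<close> recovers \<open>W\<close> from \<open>V\<close>,
    so \<open>V = 0\<close> would force \<omega> = 0.\<close>
  have "\<exists>i j. i < n \<and> j < n \<and> V $$ (i, j) \<noteq> 0"
  proof (rule ccontr)
    assume "\<not> ?thesis"
    then have "V = 0\<^sub>m n n" using V by (intro eq_matI) auto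
    moreover have "P * V * P\<^sup>T = (P * Q) * W * (P * Q)\<^sup>T"
      unfolding V_def by (rule congruence_mult[OF carr(2,3) W, symmetric])
    ultimately have "W = 0\<^sub>m n n"
      using carr W witD(1) by simp
    then have "w k l = 0" if "k < n" "l < n" for k l
    proof -
      have "w k l = W $$ (k, l)" using that by (simp add: W_def)
      then show ?thesis using \<open>W = 0\<^sub>m n n\<close> that by simp
    qed
    then have "w k l = 0" if "lex_pairs n ! q = (k, l)" "q < n choose 2" for k l q
      using lex_pairs_nth_less[OF that(2,1)] by simp
    then have "\<omega> = 0\<^sub>v (n choose 2)"
      by (subst \<omega>_eq, intro eq_vecI) (auto split: prod.split)
    then show False using \<omega> by simp
  qed
  then have ne: "{i. i < n \<and> (\<exists>j<n. V $$ (i, j) \<noteq> 0)} \<noteq> {}" by auto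
  \<comment> \<open>The last nonzero row of \<open>V\<close>, and below the last nonzero entry
    \<open>j\<close> in it. In entry \<open>(i, j)\<close> of \<open>T * V * T\<^sup>T\<close>
    triangularity kills the summands before these positions and maximality those after them.\<close>
  define i where "i = Max {i. i < n \<and> (\<exists>j<n. V $$ (i, j) \<noteq> 0)}"
  have i: "i < n" "\<exists>j<n. V $$ (i, j) \<noteq> 0"
    using Max_in[OF _ ne] by (auto simp: i_def)
  have i_max: "k \<le> i" if "k < n" "l < n" "V $$ (k, l) \<noteq> 0" for k l
    unfolding i_def using that by (intro Max_ge) auto
  have ne': "{j. j < n \<and> V $$ (i, j) \<noteq> 0} \<noteq> {}" using i by auto
  define j where "j = Max {j. j < n \<and> V $$ (i, j) \<noteq> 0}"
  have j: "j < n" "V $$ (i, j) \<noteq> 0"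
    using Max_in[OF _ ne'] by (auto simp: j_def)
  have j_max: "l \<le> j" if "l < n" "V $$ (i, l) \<noteq> 0" for l
    unfolding j_def using that by (intro Max_ge) auto
  have summand: "T $$ (i, k) * V $$ (k, l) * T $$ (j, l) =
      (if k = i then if l = j then T $$ (i, i) * V $$ (i, j) * T $$ (j, j) else 0 else 0)"
    if kl: "k < n" "l < n" for k l
  proof (cases "k = i \<and> l = j")
    case False
    have "k < i \<or> V $$ (k, l) = 0 \<or> k = i \<and> l < j"
      using False i_max[OF kl] j_max[of l] kl by (cases "k = i") fastforce+
    then show ?thesis
      using False upper_triangularD[OF tri, of k i] upper_triangularD[OF tri, of l j] i j carr by auto
  qed auto
  have "\<theta> * V $$ (i, j) = (T * V * T\<^sup>T) $$ (i, j)"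
    using TVT i j V by simp
  also have "\<dots> = (\<Sum>k<n. \<Sum>l<n. T $$ (i, k) * V $$ (k, l) * T $$ (j, l))"
    using index_mult_mult_transpose[OF carr(1) V] i j by simp
  also have "\<dots> = (\<Sum>k<n. \<Sum>l<n. if k = i then if l = j then T $$ (i, i) * V $$ (i, j) * T $$ (j, j) else 0 else 0)"
    using summand by (intro sum.cong) auto
  also have "\<dots> = (\<Sum>k<n. if k = i then T $$ (i, i) * V $$ (i, j) * T $$ (j, j) else 0)"
    using j by (intro sum.cong) auto
  also have "\<dots> = T $$ (i, i) * V $$ (i, j) * T $$ (j, j)"
    using i by simp
  finally have "\<theta> = T $$ (i, i) * T $$ (j, j)" using j by simp
  moreover have "T $$ (k, k) = es ! k" if "k < n" for k
    using that carr diag by (auto simp: diag_mat_def)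
  moreover have "i \<noteq> j" using V_diag j by metis
  ultimately show ?thesis using that i j by simp
qed

section \<open>Sign-symmetric matrices\<close>

definition sgn_in :: "nat set \<Rightarrow> nat \<Rightarrow> real" where
  "sgn_in J i = (if i \<in> J then -1 else 1)"

definition sgn_conj :: "nat set \<Rightarrow> real mat \<Rightarrow> real mat" where
  "sgn_conj J A = mat (dim_row A) (dim_col A) (\<lambda>(i, j). sgn_in J i * A $$ (i, j) * sgn_in J j)"

lemma sgn_in_mult_self [simp]: "sgn_in J i * sgn_in J i = 1"
  by (simp add: sgn_in_def)

lemma sgn_conj_carrier: "A \<in> carrier_mat n n \<Longrightarrow> sgn_conj J A \<in> carrier_mat n n"
  by (simp add: sgn_conj_def)

text \<open>The factor \<open>sgn_in J i * sgn_in J j\<close> is -1 exactly where sign-symmetry puts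
  the nonpositive entries.\<close>

lemma sgn_conj_nonneg:
  assumes "J_sign_symmetric_witness A J" "A \<in> carrier_mat n n" "i < n" "j < n"
  shows "0 \<le> sgn_conj J A $$ (i, j)"
  using assms by (fastforce simp: sgn_conj_def J_sign_symmetric_witness_def exactly_one_in_def sgn_in_def)

text \<open>The diagonal signature matrix is its own inverse, so the conjugation is a
  similarity.\<close>

lemma char_poly_sgn_conj:
  assumes A: "A \<in> carrier_mat n n"
  shows "char_poly (sgn_conj J A) = char_poly A"
proof -
  define D where "D = mat_diag n (sgn_in J)"
  have D: "D \<in> carrier_mat n n" by (simp add: D_def)
  have "D * D = 1\<^sub>m n"
    unfolding D_def mat_diag_diag by (intro eq_matI) (auto simp: mat_diag_def)
  moreover have "sgn_conj J A = D * A * D"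
    using A
    by (intro eq_matI)
      (auto simp: D_def sgn_conj_def mat_diag_mult_left[OF A] mat_diag_mult_right[of _ n n] simp del: assoc_mult_mat)
  ultimately have "similar_mat (sgn_conj J A) A"
    using A D sgn_conj_carrier[OF A] by (intro similar_matI[of _ _ D D n]) auto
  then show ?thesis by (rule char_poly_similar)
qed

lemma spectrum_cmat_sgn_conj:
  assumes "A \<in> carrier_mat n n"
  shows "spectrum (cmat (sgn_conj J A)) = spectrum (cmat A)"
  using assms sgn_conj_carrier[OF assms]
  by (simp add: spectrum_root_char_poly[of _ n] of_real_hom.char_poly_hom[of _ n] char_poly_sgn_conj)

lemma eigenvalue_cmat_sgn_conj:
  assumes "A \<in> carrier_mat n n"
  shows "eigenvalue (cmat (sgn_conj J A)) e \<longleftrightarrow> eigenvalue (cmat A) e"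
  using spectrum_cmat_sgn_conj[OF assms] by (auto simp: spectrum_def)

lemma spectral_radius_cmat_sgn_conj:
  assumes "A \<in> carrier_mat n n"
  shows "spectral_radius (cmat (sgn_conj J A)) = spectral_radius (cmat A)"
  by (simp add: spectral_radius_def spectrum_cmat_sgn_conj[OF assms])

text \<open>Perron-Frobenius for the nonnegative conjugate, carried back by similarity. It serves
  both the matrix and its compound.\<close>

lemma J_sign_symmetric_eigenvalue_spectral_radius:
  assumes A: "A \<in> carrier_mat n n" "0 < n" and J: "J_sign_symmetric_witness A J"
  shows "eigenvalue (cmat A) (of_real (spectral_radius (cmat A)))"
  using nonneg_mat_eigenvalue_spectral_radius[OF sgn_conj_carrier[OF A(1)] sgn_conj_nonneg[OF J A(1)] A(2)]
  by (simp add: eigenvalue_cmat_sgn_conj[OF A(1)] spectral_radius_cmat_sgn_conj[OF A(1)])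

text \<open>The pairs of \<^const>\<open>W_hat\<close> are those whose sign in the second compound of the conjugated matrix
  is negative, where the sign is extended to an alternating function of the pair; so in the order
  \<^const>\<open>W_hat\<close> all minors of order two of the conjugated matrix are nonnegative.\<close>

lemma sgn_conj_minors_nonneg:
  assumes A: "A \<in> carrier_mat n n" and J': "J_sign_symmetric_witness (second_compound A) J'"
    and ij: "(i, j) \<in> W_hat n J J'" and kl: "(k, l) \<in> W_hat n J J'"
  defines "b \<equiv> \<lambda>i j. sgn_conj J A $$ (i, j)"
  shows "b i l * b j k \<le> b i k * b j l"
proof -
  define s where "s = sgn_in J"
  define \<sigma> where "\<sigma> i j = s i * s j * sgn_in J' (lex_number n i j)" for i j
  have b: "b i j = s i * A $$ (i, j) * s j" if "i < n" "j < n" for i j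
    using that A by (simp add: b_def sgn_conj_def s_def)
  have key: "0 \<le> \<sigma> i j * \<sigma> k l * (b i k * b j l - b i l * b j k)"
    if "i < j" "j < n" "k < l" "l < n" for i j k l
  proof -
    have "0 \<le> sgn_conj J' (second_compound A) $$ (lex_number n i j, lex_number n k l)"
      using that by (intro sgn_conj_nonneg[OF J' second_compound_carrier[OF A]] lex_number_less)
    also have "\<dots> = sgn_in J' (lex_number n i j) * sgn_in J' (lex_number n k l) *
        (A $$ (i, k) * A $$ (j, l) - A $$ (i, l) * A $$ (j, k))"
      using that second_compound_carrier[OF A]
      by (simp add: sgn_conj_def lex_number_less second_compound_lex_number[OF A] mult_ac)
    \<comment> \<open>Inserting squares of signs turns the entries of \<open>A\<close> into those of
      \<open>b\<close> and completes the compound signs to \<sigma>.\<close>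
    also have "\<dots> = (s i * s i) * (s j * s j) * (s k * s k) * (s l * s l) *
        (sgn_in J' (lex_number n i j) * sgn_in J' (lex_number n k l) *
        (A $$ (i, k) * A $$ (j, l) - A $$ (i, l) * A $$ (j, k)))"
      by (simp add: s_def)
    also have "\<dots> = \<sigma> i j * \<sigma> k l * (b i k * b j l - b i l * b j k)"
      using that by (simp add: \<sigma>_def b algebra_simps)
    finally show ?thesis .
  qed
  have less: "\<sigma> i j = -1" if "i < j" "(i, j) \<in> W_hat n J J'" for i j
    using that by (auto simp: W_hat_def exactly_one_in_def \<sigma>_def s_def sgn_in_def)
  have greater: "\<sigma> j i = 1" if "j < i" "(i, j) \<in> W_hat n J J'" for i j
    using that by (auto simp: W_hat_def exactly_one_in_def \<sigma>_def s_def sgn_in_def)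
  have "i < n" "j < n" "k < n" "l < n" using ij kl by (auto simp: W_hat_def)
  \<comment> \<open>For \<open>i = j\<close> or \<open>k = l\<close> both sides coincide. Otherwise
    reversing a pair flips both its sign and the sign of the minor, so all four orientations reduce
    to \<open>key\<close>.\<close>
  then show ?thesis
    using key[of i j k l] key[of i j l k] key[of j i k l] key[of j i l k]
      less[OF _ ij] less[OF _ kl] greater[OF _ ij] greater[OF _ kl]
    by (cases i j rule: linorder_cases; cases k l rule: linorder_cases) (simp_all add: mult.commute)
qed

text \<open>Links the two views of the compound: its sign pattern lives over the reals, its
  eigenvalues are products over the complex numbers.\<close>

lemma second_compound_cmat:
  assumes "A \<in> carrier_mat n n"
  shows "second_compound (cmat A) = cmat (second_compound A)"
proof (rule eq_matI)
  fix p q assume "p < dim_row (cmat (second_compound A))" "q < dim_col (cmat (second_compound A))"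
  then have pq: "p < n choose 2" "q < n choose 2" using second_compound_carrier[OF assms] by auto
  obtain i j k l where ij: "lex_pairs n ! p = (i, j)" and kl: "lex_pairs n ! q = (k, l)" by fastforce
  show "second_compound (cmat A) $$ (p, q) = cmat (second_compound A) $$ (p, q)"
    using assms pq ij kl lex_pairs_nth_less[OF pq(1) ij] lex_pairs_nth_less[OF pq(2) kl]
    by (simp add: second_compound_def Let_def minor2_def)
qed (use assms in \<open>simp_all add: second_compound_def Let_def\<close>)

section \<open>Locating the second eigenvalue and ordering the spectrum\<close>

theorem theorem12:
  fixes n :: nat and A :: "real mat" and J J' :: "nat set"
  assumes "n \<ge> 2"
    and "A \<in> carrier_mat n n"
    and "J_sign_symmetric_witness A J"
    and "J_sign_symmetric_witness (second_compound A) J'"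
    and "W_hat_transitive n J J'"
  shows "\<exists>es :: complex list. length es = n \<and> eigenvalue_enumeration A es \<and>
           sorted_wrt (\<lambda>x y. cmod x \<ge> cmod y) es \<and>
           es ! 0 \<in> \<real>\<^sub>\<ge>\<^sub>0 \<and> es ! 1 \<in> \<real>\<^sub>\<ge>\<^sub>0"
proof -
  note A = assms(2) and J = assms(3) and J' = assms(4)
  have cA: "cmat A \<in> carrier_mat n n" using A by simp
  define \<rho> where "\<rho> = spectral_radius (cmat A)"
  have ev\<rho>: "eigenvalue (cmat A) (of_real \<rho>)"
    unfolding \<rho>_def using assms(1) by (intro J_sign_symmetric_eigenvalue_spectral_radius[OF A _ J]) simp
  have \<rho>0: "0 \<le> \<rho>"
    unfolding \<rho>_def using assms(1) by (intro spectral_radius_nonneg[OF cA]) simp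
  have peripheral: "e = of_real \<rho>" if "eigenvalue (cmat A) e" "cmod e = \<rho>" for e
    using peripheral_eigenvalue_unique[OF sgn_conj_carrier[OF A] assms(5)[unfolded W_hat_transitive_def]
        sgn_conj_nonneg[OF J A] sgn_conj_minors_nonneg[OF A J'], of e] that
    by (simp add: eigenvalue_cmat_sgn_conj[OF A] spectral_radius_cmat_sgn_conj[OF A] \<rho>_def)
  obtain es0 where es0: "char_poly (cmat A) = (\<Prod>e\<leftarrow>es0. [:- e, 1:])" "length es0 = n"
    using char_poly_factorized[OF cA] by blast
  have prod_eq: "char_poly (cmat A) = (\<Prod>e\<leftarrow>es. [:- e, 1:])" if "mset es = mset es0" for es
    unfolding es0(1) prod_mset_prod_list[symmetric] mset_map that ..
  have in_es0: "e \<in> set es0 \<longleftrightarrow> eigenvalue (cmat A) e" for e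
    unfolding eigenvalue_root_char_poly[OF cA] es0(1)
    by (auto simp: poly_prod_list)
  \<comment> \<open>Only one copy of \<rho> is removed, so a multiple eigenvalue \<rho> still occurs
    in \<open>L\<close>.\<close>
  define L where "L = remove1 (of_real \<rho>) es0"
  have L: "mset (of_real \<rho> # L) = mset es0" and "length L = n - 1"
    using ev\<rho> es0(2) in_es0 by (simp_all add: L_def length_remove1)
  then have "L \<noteq> []" using assms(1) by auto
  then have "Max (cmod ` set L) \<in> cmod ` set L" by (intro Max_in) auto
  then obtain x where x: "x \<in> set L" "cmod x = Max (cmod ` set L)" by auto
  have x_max: "cmod y \<le> cmod x" if "y \<in> set L" for y
    using that by (simp add: x)
  have evL: "eigenvalue (cmat A) y" if "y \<in> set L" for y
    using that in_es0 notin_set_remove1 unfolding L_def by metis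
  have le_\<rho>: "cmod y \<le> \<rho>" if "y \<in> set L" for y
    unfolding \<rho>_def by (rule norm_eigenvalue_le_spectral_radius[OF cA evL[OF that]])
  have z: "complex_of_real (cmod x) \<in> set L"
  proof -
    consider "x = 0" | "cmod x = \<rho>" | "x \<noteq> 0" "cmod x < \<rho>"
      using le_\<rho>[OF x(1)] by fastforce
    then show ?thesis
    proof cases
      case 1
      then show ?thesis using x by simp
    next
      \<comment> \<open>Uniqueness on the peripheral circle gives \<open>x = \<rho>\<close>, which
        is then a multiple eigenvalue.\<close>
      case 2
      then show ?thesis using peripheral[OF evL[OF x(1)]] x by simp
    next
      case 3
      then have "0 < \<rho>" using le_less_trans norm_ge_zero by blast
      define N where "N = cmat (second_compound A)"
      have N: "N \<in> carrier_mat (n choose 2) (n choose 2)"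
        using second_compound_carrier[OF A] by (simp add: N_def)
      define \<theta> where "\<theta> = spectral_radius N"
      have "0 < n choose 2" using assms(1) by simp
      then have "eigenvalue N (of_real \<theta>)"
        unfolding \<theta>_def N_def
        by (intro J_sign_symmetric_eigenvalue_spectral_radius[OF second_compound_carrier[OF A] _ J'])
      \<comment> \<open>The positions are distinct, so at most one of the two factors is the leading
        \<rho>.\<close>
      then obtain i j where ij: "i < n" "j < n" "i \<noteq> j"
          "of_real \<theta> = (of_real \<rho> # L) ! i * (of_real \<rho> # L) ! j"
        using eigenvalue_second_compound_imp_mult[OF cA prod_eq[OF L]]
        unfolding N_def second_compound_cmat[OF A] by blast
      \<comment> \<open>Distinctness makes \<open>\<rho> * x\<close> an eigenvalue of the compound,
        which bounds \<theta> from below.\<close>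
      have "of_real \<rho> \<noteq> x" using 3 \<rho>0 by auto
      from eigenvalue_second_compound_mult[OF cA ev\<rho> evL[OF x(1)] this]
      have "cmod (of_real \<rho> * x) \<le> \<theta>"
        unfolding \<theta>_def N_def second_compound_cmat[OF A]
        by (intro norm_eigenvalue_le_spectral_radius[OF N[unfolded N_def]])
      then have \<theta>: "\<rho> * cmod x \<le> \<theta>" using \<rho>0 by (simp add: norm_mult)
      have "\<exists>m<length L. of_real \<theta> = of_real \<rho> * L ! m"
      proof (cases i)
        case 0
        then obtain m where "j = Suc m" using ij by (cases j) auto
        then show ?thesis using 0 ij \<open>length L = n - 1\<close> by (intro exI[of _ m]) auto
      next
        case (Suc i')
        show ?thesis
        proof (cases j)
          case 0
          then show ?thesis using Suc ij \<open>length L = n - 1\<close> by (intro exI[of _ i']) (auto simp: mult.commute)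
        next
          \<comment> \<open>Two factors from \<open>L\<close> are too small: their product has
            modulus at most \<open>cmod x * cmod x\<close>, below \<theta>.\<close>
          case (Suc j')
          have "cmod (L ! i') \<le> cmod x" "cmod (L ! j') \<le> cmod x"
            using x_max ij \<open>i = Suc i'\<close> \<open>j = Suc j'\<close> \<open>length L = n - 1\<close> by auto
          then have "cmod (L ! i' * L ! j') \<le> cmod x * cmod x"
            unfolding norm_mult by (intro mult_mono) auto
          also have "\<dots> < \<rho> * cmod x" using 3 by simp
          also have "\<dots> \<le> cmod (of_real \<theta>)" using \<theta> by simp
          finally show ?thesis using ij \<open>i = Suc i'\<close> \<open>j = Suc j'\<close> by simp
        qed
      qed
      then obtain m where m: "m < length L" "of_real \<theta> = of_real \<rho> * L ! m" by auto
      have Lm: "L ! m = of_real (\<theta> / \<rho>)" using m(2) \<open>0 < \<rho>\<close> by (simp add: field_simps)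
      have "cmod x \<le> \<theta> / \<rho>" using \<theta> \<open>0 < \<rho>\<close> by (simp add: field_simps)
      moreover have "\<theta> / \<rho> \<le> cmod x"
        using x_max[OF nth_mem[OF m(1)]] unfolding Lm norm_of_real by linarith
      ultimately have "L ! m = of_real (cmod x)" using Lm by simp
      then show ?thesis using nth_mem[OF m(1)] by simp
    qed
  qed
  \<comment> \<open>The key is negated because \<open>sort_key\<close> sorts in ascending
    order.\<close>
  define R where "R = sort_key (\<lambda>y. - cmod y) (remove1 (of_real (cmod x)) L)"
  define es where "es = complex_of_real \<rho> # of_real (cmod x) # R"
  have "mset es = mset es0"
    using z by (simp add: es_def R_def L[symmetric])
  moreover have "set R \<subseteq> set L"
    by (simp add: R_def set_remove1_subset)
  moreover have "sorted_wrt (\<lambda>x y. cmod x \<ge> cmod y) R"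
    using sorted_sort_key[of "\<lambda>y. - cmod y" "remove1 (of_real (cmod x)) L"]
    unfolding R_def[symmetric] sorted_map by simp
  ultimately show ?thesis
    using prod_eq[of es] es0(2) mset_eq_length[of es es0] \<rho>0 le_\<rho> x_max x(1)
    by (intro exI[of _ es]) (auto simp: es_def eigenvalue_enumeration_def)
qed

end
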